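(* Let $X$ be a topological space and let $I,J:X\to\mathbb{R}$ be two sequentially lower semicontinuous functions. Assume that $J$ is sequentially inf-compact and that, for some $c>0$, one has $$\inf_{x\in J^{-1}(]c,+\infty[)}\frac{I(x)}{J(x)}=-\infty.$$ Then there exists a divergent sequence $\{\lambda_n^*\}$ in $]0,+\infty[$ with the following property: for every $n\in\mathbb{N}$ and for every increasing and lower semicontinuous function $\varphi:J(X)\to\mathbb{R}$ such that $I+\mu\,\varphi\circ J$ is sequentially inf-compact for all $\mu>0$, there exists $\mu^*>0$ such that the function $I+\lambda_n^*J+\mu^*\varphi\circ J$ has at least two global minima in $X$.
   Context: A real-valued function $g$ on a topological space is said to be sequentially inf-compact if, for each $r\in\mathbb{R}$, the set $g^{-1}(]-\infty,r])$ is sequentially compact (every sequence in the set has a subsequence converging to a point of the set). A function $g:X\to\mathbb{R}$ is sequentially lower semicontinuous if $g(x)\leq\liminf_{n\to\infty}g(x_n)$ whenever $x_n\to x$ in $X$. "Increasing" means strictly increasing (as opposed to "non-decreasing"). $J(X)\subseteq\mathbb{R}$ carries the topology induced by $\mathbb{R}$. $]a,b[$ denotes an open interval. A divergent sequence in $]0,+\infty[$ is one tending to $+\infty$. A "global minimum" of a function is a point at which it attains its infimum over $X$; "at least two global minima" means at least two distinct such points. *)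

theory Defs
  imports "HOL-Analysis.Analysis"
begin

text \<open>The liminf is taken in the extended reals, where it always exists.\<close>

definition seq_lsc :: "('a::topological_space \<Rightarrow> real) \<Rightarrow> bool" where
  "seq_lsc g \<longleftrightarrow>
     (\<forall>x \<xi>. \<xi> \<longlonglongrightarrow> x \<longrightarrow> ereal (g x) \<le> liminf (\<lambda>n. ereal (g (\<xi> n))))"

definition seq_inf_compact :: "('a::topological_space \<Rightarrow> real) \<Rightarrow> bool" where
  "seq_inf_compact g \<longleftrightarrow> (\<forall>r. seq_compact (g -` {..r}))"

text \<open>Lower semicontinuity of the restriction of \<^term>\<open>f\<close> to \<^term>\<open>S\<close>, with respect to the
  induced topology; values of \<^term>\<open>f\<close> outside \<^term>\<open>S\<close> play no role.\<close>

definition lsc_on :: "'a::topological_space set \<Rightarrow> ('a \<Rightarrow> real) \<Rightarrow> bool" where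
  "lsc_on S f \<longleftrightarrow> (\<forall>a. openin (top_of_set S) {t \<in> S. a < f t})"

definition global_minimum :: "('a \<Rightarrow> real) \<Rightarrow> 'a \<Rightarrow> bool" where
  "global_minimum f x \<longleftrightarrow> is_arg_min f (\<lambda>_. True) x"

end

theory Submission
  imports Defs
begin

text \<open>
  The conclusion holds for every sufficiently large \<open>\<lambda>\<close>. Put \<open>H = I + \<lambda> J\<close> and \<open>P = \<phi> \<circ> J\<close>.
  Since \<open>I\<close> is bounded below on the sublevels of \<open>J\<close>, the hypothesis on \<open>I / J\<close> makes \<open>J\<close>
  unbounded above and \<open>H\<close> unbounded below. Fix a value \<open>s\<close> of \<open>J\<close> above its minimum, attained
  at \<open>x\<^sub>1\<close>. If \<open>\<lambda>\<close> is large then \<open>H x\<^sub>1 \<le> H x\<close> whenever \<open>J x = s\<close>, so no minimizer of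
  \<open>H + \<mu> P\<close> lies on \<open>{P = \<phi> s}\<close>. For small \<open>\<mu>\<close> the minimizers lie in \<open>{P > \<phi> s}\<close>, for large
  \<open>\<mu>\<close> in \<open>{P < \<phi> s}\<close>, and at the critical parameter limits of minimizers from both sides are
  minimizers, one in each region.
\<close>

section \<open>Sequential lower semicontinuity: sums, multiples, composition\<close>

lemma seq_lsc_iff:
  "seq_lsc g \<longleftrightarrow> (\<forall>x \<xi> a. \<xi> \<longlonglongrightarrow> x \<longrightarrow> a < g x \<longrightarrow> (\<forall>\<^sub>F n in sequentially. a < g (\<xi> n)))"
proof
  assume g: "seq_lsc g"
  show "\<forall>x \<xi> a. \<xi> \<longlonglongrightarrow> x \<longrightarrow> a < g x \<longrightarrow> (\<forall>\<^sub>F n in sequentially. a < g (\<xi> n))"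
  proof (intro allI impI)
    fix x \<xi> a assume "\<xi> \<longlonglongrightarrow> x" "a < g x"
    then have "ereal a < liminf (\<lambda>n. ereal (g (\<xi> n)))"
      using g unfolding seq_lsc_def by (meson less_ereal.simps(1) less_le_trans)
    then show "\<forall>\<^sub>F n in sequentially. a < g (\<xi> n)"
      by (auto dest: less_LiminfD)
  qed
next
  assume *: "\<forall>x \<xi> a. \<xi> \<longlonglongrightarrow> x \<longrightarrow> a < g x \<longrightarrow> (\<forall>\<^sub>F n in sequentially. a < g (\<xi> n))"
  show "seq_lsc g"
    unfolding seq_lsc_def le_Liminf_iff
  proof (intro allI impI)
    fix x \<xi> y assume "\<xi> \<longlonglongrightarrow> x" and y: "y < ereal (g x)"
    then show "\<forall>\<^sub>F n in sequentially. y < ereal (g (\<xi> n))"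
      \<comment> \<open>For infinite \<open>y\<close> nothing remains: \<open>\<infinity>\<close> is
        not below \<open>g x\<close>, and \<open>-\<infinity>\<close> is below every real
        value.\<close>
      using * by (cases y) auto
  qed
qed

lemma seq_lscD:
  "seq_lsc g \<Longrightarrow> \<xi> \<longlonglongrightarrow> x \<Longrightarrow> a < g x \<Longrightarrow> \<forall>\<^sub>F n in sequentially. a < g (\<xi> n)"
  by (auto simp: seq_lsc_iff)

lemma seq_lsc_add:
  assumes f: "seq_lsc f" and g: "seq_lsc g"
  shows "seq_lsc (\<lambda>x. f x + g x)"
  unfolding seq_lsc_iff
proof (intro allI impI)
  fix x \<xi> a assume \<xi>: "\<xi> \<longlonglongrightarrow> x" and a: "a < f x + g x"
  define e where "e = (f x + g x - a) / 2"
  have "e > 0" using a by (simp add: e_def)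
  then have "\<forall>\<^sub>F n in sequentially. f x - e < f (\<xi> n)" "\<forall>\<^sub>F n in sequentially. g x - e < g (\<xi> n)"
    by (auto intro: seq_lscD[OF f \<xi>] seq_lscD[OF g \<xi>])
  then show "\<forall>\<^sub>F n in sequentially. a < f (\<xi> n) + g (\<xi> n)"
    by eventually_elim (simp add: e_def field_simps)
qed

lemma seq_lsc_cmult:
  assumes g: "seq_lsc g" and k: "k > 0"
  shows "seq_lsc (\<lambda>x. k * g x)"
  unfolding seq_lsc_iff
proof (intro allI impI)
  fix x \<xi> a assume \<xi>: "\<xi> \<longlonglongrightarrow> x" and a: "a < k * g x"
  then have "\<forall>\<^sub>F n in sequentially. a / k < g (\<xi> n)"
    using k by (intro seq_lscD[OF g \<xi>]) (simp add: field_simps)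
  then show "\<forall>\<^sub>F n in sequentially. a < k * g (\<xi> n)"
    by eventually_elim (use k in \<open>simp add: field_simps\<close>)
qed

text \<open>Monotonicity handles the indices with \<open>J (\<xi> n) \<ge> J x\<close>. The others
  eventually have \<open>J (\<xi> n)\<close> within \<open>e\<close> below \<open>J x\<close>, where
  lower semicontinuity of \<open>\<phi>\<close> on \<open>range J\<close> applies.\<close>

lemma seq_lsc_compose_mono:
  assumes J: "seq_lsc J" and mono: "mono_on (range J) \<phi>" and lsc: "lsc_on (range J) \<phi>"
  shows "seq_lsc (\<lambda>x. \<phi> (J x))"
  unfolding seq_lsc_iff
proof (intro allI impI)
  fix x \<xi> a assume \<xi>: "\<xi> \<longlonglongrightarrow> x" and a: "a < \<phi> (J x)"
  obtain T where T: "open T" "{t \<in> range J. a < \<phi> t} = range J \<inter> T"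
    using lsc unfolding lsc_on_def openin_open by blast
  then have "J x \<in> T" using a by blast
  then obtain e where e: "e > 0" "ball (J x) e \<subseteq> T"
    using T(1) openE by blast
  have "\<forall>\<^sub>F n in sequentially. J x - e < J (\<xi> n)"
    using e by (intro seq_lscD[OF J \<xi>]) simp
  then show "\<forall>\<^sub>F n in sequentially. a < \<phi> (J (\<xi> n))"
  proof eventually_elim
    case (elim n)
    show ?case
    proof (cases "J (\<xi> n) < J x")
      case True
      then have "J (\<xi> n) \<in> T" using elim e by (auto simp: dist_real_def)
      then show ?thesis using T(2) by blast
    next
      case False
      then have "\<phi> (J x) \<le> \<phi> (J (\<xi> n))"
        using mono by (auto intro: mono_onD)
      then show ?thesis using a by simp
    qed
  qed
qed

section \<open>Sequential compactness and attained infima\<close>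

lemma seq_lsc_attains_inf:
  assumes g: "seq_lsc g" and K: "seq_compact K" "K \<noteq> {}"
  obtains x where "x \<in> K" "\<And>y. y \<in> K \<Longrightarrow> g x \<le> g y"
proof -
  \<comment> \<open>Taking the infimum in the extended reals gives a minimizing sequence before
    \<open>g\<close> is known to be bounded below on \<open>K\<close>.\<close>
  define A where "A = (\<lambda>x. ereal (g x)) ` K"
  obtain u where u: "\<And>n. u n \<in> A" "u \<longlonglongrightarrow> Inf A"
    using Inf_as_limit[of A] K(2) by (auto simp: A_def)
  then obtain \<xi> where \<xi>: "\<And>n. \<xi> n \<in> K" "\<And>n. u n = ereal (g (\<xi> n))"
    unfolding A_def image_iff by metis
  obtain x r where x: "x \<in> K" "strict_mono r" "(\<xi> \<circ> r) \<longlonglongrightarrow> x"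
    using K(1) \<xi>(1) unfolding seq_compact_def by blast
  have "(\<lambda>n. ereal (g ((\<xi> \<circ> r) n))) \<longlonglongrightarrow> Inf A"
    using LIMSEQ_subseq_LIMSEQ[OF u(2) x(2)] by (simp add: \<xi>(2) o_def)
  then have "ereal (g x) \<le> Inf A"
    using g x(3) lim_imp_Liminf[OF sequentially_bot] unfolding seq_lsc_def by metis
  then have "g x \<le> g y" if "y \<in> K" for y
    using that unfolding A_def le_Inf_iff by auto
  with x(1) show thesis by (rule that)
qed

lemma seq_inf_compact_attains_inf:
  assumes "seq_lsc g" "seq_inf_compact g"
  obtains x where "\<And>y. g x \<le> g y"
proof -
  fix z
  have K: "seq_compact (g -` {..g z})" "g -` {..g z} \<noteq> {}"
    using assms(2) by (auto simp: seq_inf_compact_def)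
  obtain x where "x \<in> g -` {..g z}" "\<And>y. y \<in> g -` {..g z} \<Longrightarrow> g x \<le> g y"
    using seq_lsc_attains_inf[OF assms(1) K] by blast
  then have "g x \<le> g y" for y
    by (metis atMost_iff linorder_le_cases order_trans vimageI)
  then show thesis by (rule that)
qed

text \<open>A sublevel of \<open>g\<close> lies in a sublevel of \<open>f\<close>, which supplies a
  convergent subsequence; lower semicontinuity of \<open>g\<close> keeps its limit in the sublevel
  of \<open>g\<close>.\<close>

lemma seq_inf_compact_mono:
  assumes f: "seq_inf_compact f" and g: "seq_lsc g" and le: "\<And>x. f x \<le> g x + C"
  shows "seq_inf_compact g"
  unfolding seq_inf_compact_def seq_compact_def
proof (intro allI impI)
  fix r :: real and \<xi> :: "nat \<Rightarrow> 'a" assume \<xi>: "\<forall>n. \<xi> n \<in> g -` {..r}"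
  have "\<xi> n \<in> f -` {..r + C}" for n
    using \<xi>[rule_format, of n] le[of "\<xi> n"] by simp
  then obtain x \<rho> where x: "strict_mono \<rho>" "(\<xi> \<circ> \<rho>) \<longlonglongrightarrow> x"
    using f unfolding seq_inf_compact_def seq_compact_def by blast
  have "g x \<le> r"
  proof (rule ccontr)
    assume "\<not> g x \<le> r"
    then have "\<forall>\<^sub>F n in sequentially. r < g ((\<xi> \<circ> \<rho>) n)"
      by (intro seq_lscD[OF g x(2)]) simp
    then have "\<exists>n. r < g ((\<xi> \<circ> \<rho>) n)"
      using eventually_happens'[OF sequentially_bot] by blast
    then show False using \<xi> by (auto simp: not_le[symmetric])
  qed
  with x show "\<exists>l\<in>g -` {..r}. \<exists>\<rho>. strict_mono \<rho> \<and> (\<xi> \<circ> \<rho>) \<longlonglongrightarrow> l" by auto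
qed

section \<open>Minimizers of \<open>H + \<mu> P\<close> as the parameter varies\<close>

lemma global_minimum_iff: "global_minimum f x \<longleftrightarrow> (\<forall>y. f x \<le> f y)"
  by (auto simp: global_minimum_def is_arg_min_linorder)

text \<open>Lower semicontinuity alone would carry only upper bounds on \<open>P\<close> to the
  limit point; minimality upgrades it to convergence of the values of \<open>P\<close>, so lower
  bounds pass to the limit too.\<close>

lemma global_minimum_limit:
  fixes H P :: "'a::topological_space \<Rightarrow> real"
  assumes H: "seq_lsc H" and P: "seq_lsc P" and p: "\<And>x. p \<le> P x"
    and compact: "\<And>\<mu>. \<mu> > 0 \<Longrightarrow> seq_inf_compact (\<lambda>x. H x + \<mu> * P x)"
    and m: "m \<longlonglongrightarrow> \<mu>" "\<mu> > 0"
    and min: "\<And>n. global_minimum (\<lambda>x. H x + m n * P x) (\<xi> n)"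
  obtains x \<rho> where "strict_mono \<rho>" "(\<lambda>n. P (\<xi> (\<rho> n))) \<longlonglongrightarrow> P x"
    "global_minimum (\<lambda>x. H x + \<mu> * P x) x"
proof -
  have le: "H (\<xi> n) + m n * P (\<xi> n) \<le> H z + m n * P z" for n z
    using min by (auto simp: global_minimum_iff)
  fix z0 :: 'a
  \<comment> \<open>Once \<open>m n > \<mu> / 2\<close>, comparison with \<open>z0\<close> and
    \<open>p \<le> P\<close> bound \<open>H + \<mu> / 2 * P\<close> along the minimizers. Thus a
    single sublevel, for the fixed parameter \<open>\<mu> / 2\<close>, contains almost all of them;
    the \<open>+ 1\<close> in \<open>R\<close> is slack above the limit.\<close>
  have "(\<lambda>n. H z0 + m n * P z0 - (m n - \<mu> / 2) * p) \<longlonglongrightarrow> H z0 + \<mu> * P z0 - (\<mu> - \<mu> / 2) * p"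
    by (intro tendsto_intros m)
  moreover define R where "R = H z0 + \<mu> * P z0 - (\<mu> - \<mu> / 2) * p + 1"
  ultimately have ev1: "\<forall>\<^sub>F n in sequentially. H z0 + m n * P z0 - (m n - \<mu> / 2) * p < R"
    by (intro order_tendstoD(2)) auto
  have "\<forall>\<^sub>F n in sequentially. \<mu> / 2 < m n"
    using m by (intro order_tendstoD(1)[of m \<mu>]) auto
  with ev1 have "\<forall>\<^sub>F n in sequentially. H (\<xi> n) + \<mu> / 2 * P (\<xi> n) \<le> R"
  proof eventually_elim
    case (elim n)
    have "(m n - \<mu> / 2) * p \<le> (m n - \<mu> / 2) * P (\<xi> n)"
      using elim p by (intro mult_left_mono) auto
    then show ?case using elim le[of n z0] by (simp add: algebra_simps)
  qed
  then obtain N where N: "\<And>n. n \<ge> N \<Longrightarrow> H (\<xi> n) + \<mu> / 2 * P (\<xi> n) \<le> R"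
    by (auto simp: eventually_sequentially)
  have K: "seq_compact ((\<lambda>x. H x + \<mu> / 2 * P x) -` {..R})"
    using compact[of "\<mu> / 2"] m(2) by (simp add: seq_inf_compact_def)
  have "\<forall>n. \<xi> (n + N) \<in> (\<lambda>x. H x + \<mu> / 2 * P x) -` {..R}"
    using N by simp
  then obtain x r where x: "strict_mono r" "((\<lambda>n. \<xi> (n + N)) \<circ> r) \<longlonglongrightarrow> x"
    by (rule seq_compactE[OF K])
  define \<rho> where "\<rho> n = r n + N" for n
  have \<rho>: "strict_mono \<rho>" using x(1) by (simp add: strict_mono_def \<rho>_def)
  have lim: "(\<lambda>n. \<xi> (\<rho> n)) \<longlonglongrightarrow> x" using x(2) by (simp add: o_def \<rho>_def)
  have m\<rho>: "(\<lambda>n. m (\<rho> n)) \<longlonglongrightarrow> \<mu>"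
    using LIMSEQ_subseq_LIMSEQ[OF m(1) \<rho>] by (simp add: o_def)
  have Hev: "\<forall>\<^sub>F n in sequentially. H x - e < H (\<xi> (\<rho> n))" if "e > 0" for e
    using that by (intro seq_lscD[OF H lim]) simp
  have Pev: "\<forall>\<^sub>F n in sequentially. P x - e < P (\<xi> (\<rho> n))" if "e > 0" for e
    using that by (intro seq_lscD[OF P lim]) simp
  have mpos: "\<forall>\<^sub>F n in sequentially. 0 < m (\<rho> n)"
    using m\<rho> m(2) by (rule order_tendstoD(1))
  have "H x + \<mu> * P x \<le> H z + \<mu> * P z" for z
  proof (rule field_le_epsilon)
    fix e :: real assume e: "e > 0"
    \<comment> \<open>Losing \<open>d\<close> in both \<open>H\<close> and \<open>P\<close> costs
      \<open>d + \<mu> * d = e\<close> in the limit.\<close>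
    define d where "d = e / (1 + \<mu>)"
    have d: "d > 0" using e m(2) by (simp add: d_def)
    have lims: "(\<lambda>n. H x - d + m (\<rho> n) * (P x - d)) \<longlonglongrightarrow> H x - d + \<mu> * (P x - d)"
      "(\<lambda>n. H z + m (\<rho> n) * P z) \<longlonglongrightarrow> H z + \<mu> * P z"
      by (intro tendsto_intros m\<rho>)+
    have "\<forall>\<^sub>F n in sequentially. H x - d + m (\<rho> n) * (P x - d) \<le> H z + m (\<rho> n) * P z"
      using Hev[OF d] Pev[OF d] mpos
    proof eventually_elim
      case (elim n)
      then have "m (\<rho> n) * (P x - d) \<le> m (\<rho> n) * P (\<xi> (\<rho> n))"
        by (intro mult_left_mono) auto
      then show ?case using elim(1) le[of "\<rho> n" z] by linarith
    qed
    then have "H x - d + \<mu> * (P x - d) \<le> H z + \<mu> * P z"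
      by (rule tendsto_le[OF sequentially_bot lims(2,1)])
    moreover have "d * (1 + \<mu>) = e"
      using m(2) by (simp add: d_def)
    ultimately show "H x + \<mu> * P x \<le> H z + \<mu> * P z + e"
      by (simp add: algebra_simps)
  qed
  then have min': "global_minimum (\<lambda>x. H x + \<mu> * P x) x"
    by (simp add: global_minimum_iff)
  have "(\<lambda>n. P (\<xi> (\<rho> n))) \<longlonglongrightarrow> P x"
  proof (rule order_tendstoI)
    fix a assume "a < P x"
    then show "\<forall>\<^sub>F n in sequentially. a < P (\<xi> (\<rho> n))" by (rule seq_lscD[OF P lim])
  next
    fix a assume a: "P x < a"
    \<comment> \<open>Comparing \<open>\<xi> (\<rho> n)\<close> with \<open>x\<close> gives
      \<open>m * P (\<xi> (\<rho> n)) < m * P x + d\<close> for \<open>m = m (\<rho> n)\<close>;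
      since \<open>m > \<mu> / 2\<close>, this \<open>d\<close> is at most
      \<open>m * (a - P x)\<close>.\<close>
    define d where "d = \<mu> / 2 * (a - P x)"
    have d: "d > 0" using a m(2) by (simp add: d_def)
    have "\<forall>\<^sub>F n in sequentially. \<mu> / 2 < m (\<rho> n)"
      using m(2) by (intro order_tendstoD(1)[OF m\<rho>]) simp
    then show "\<forall>\<^sub>F n in sequentially. P (\<xi> (\<rho> n)) < a"
      using Hev[OF d] mpos
    proof eventually_elim
      case (elim n)
      have "m (\<rho> n) * P (\<xi> (\<rho> n)) < m (\<rho> n) * P x + d"
        using elim(2) le[of "\<rho> n" x] by linarith
      also have "d \<le> m (\<rho> n) * (a - P x)"
        unfolding d_def using elim a by (intro mult_right_mono) auto
      finally have "m (\<rho> n) * P (\<xi> (\<rho> n)) < m (\<rho> n) * a"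
        by (simp add: algebra_simps)
      then show ?case using elim by simp
    qed
  qed
  with \<rho> show thesis using min' by (rule that)
qed

text \<open>The point \<open>x1\<close> beats the whole level \<open>P = q\<close> for every
  positive parameter, so minimizers avoid that level. The point \<open>x2\<close>, with
  \<open>H x2\<close> below the bound \<open>W\<close> for \<open>H\<close> on
  \<open>P \<le> q\<close>, drives minimizers above \<open>q\<close> for a small parameter.\<close>

lemma two_global_minima:
  fixes H P :: "'a::topological_space \<Rightarrow> real"
  assumes H: "seq_lsc H" and P: "seq_lsc P" and p: "\<And>x. p \<le> P x"
    and compact: "\<And>\<mu>. \<mu> > 0 \<Longrightarrow> seq_inf_compact (\<lambda>x. H x + \<mu> * P x)"
    and x1: "P x1 < q" "\<And>x. P x = q \<Longrightarrow> H x1 \<le> H x"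
    and x2: "\<And>x. P x \<le> q \<Longrightarrow> W \<le> H x" "H x2 < W"
  shows "\<exists>\<nu>>0. \<exists>x y. x \<noteq> y \<and> global_minimum (\<lambda>z. H z + \<nu> * P z) x \<and>
           global_minimum (\<lambda>z. H z + \<nu> * P z) y"
proof -
  define M where "M \<mu> x \<longleftrightarrow> global_minimum (\<lambda>z. H z + \<mu> * P z) x" for \<mu> x
  have M_le: "H x + \<mu> * P x \<le> H y + \<mu> * P y" if "M \<mu> x" for \<mu> x y
    using that by (auto simp: M_def global_minimum_iff)
  have M_ex: "\<exists>x. M \<mu> x" if "\<mu> > 0" for \<mu>
    using seq_inf_compact_attains_inf[OF seq_lsc_add[OF H seq_lsc_cmult[OF P that]] compact[OF that]]
    by (auto simp: M_def global_minimum_iff)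
  have M_neq: "P x \<noteq> q" if "M \<mu> x" "\<mu> > 0" for \<mu> x
  proof
    assume "P x = q"
    then have "\<mu> * P x1 < \<mu> * P x" "H x1 \<le> H x" using x1 that by auto
    then show False using M_le[OF that(1), of x1] by simp
  qed

  define S where "S = {\<mu>. \<mu> > 0 \<and> (\<exists>x. M \<mu> x \<and> q < P x)}"

  \<comment> \<open>With this choice \<open>x2\<close> has value
    \<open>W + \<mu>0 * p - \<mu>0\<close>, whereas points with \<open>P \<le> q\<close> have value
    at least \<open>W + \<mu>0 * p\<close>.\<close>
  define \<mu>0 where "\<mu>0 = (W - H x2) / (P x2 - p + 1)"
  have den: "P x2 - p + 1 > 0" using p[of x2] by simp
  have \<mu>0: "\<mu>0 > 0" using den x2(2) by (simp add: \<mu>0_def)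
  obtain z where z: "M \<mu>0 z" using M_ex[OF \<mu>0] by blast
  have "q < P z"
  proof (rule ccontr)
    assume "\<not> q < P z"
    then have "W \<le> H z" using x2(1) by simp
    moreover have "\<mu>0 * p \<le> \<mu>0 * P z" using p \<mu>0 by (intro mult_left_mono) auto
    moreover have "\<mu>0 * (P x2 - p + 1) = W - H x2" using den by (simp add: \<mu>0_def)
    then have "H x2 + \<mu>0 * P x2 = W + \<mu>0 * p - \<mu>0" by (simp add: algebra_simps)
    ultimately show False
      using M_le[OF z, of x2] \<mu>0 by linarith
  qed
  with z \<mu>0 have S0: "\<mu>0 \<in> S" by (auto simp: S_def)

  \<comment> \<open>No lower bound on \<open>H\<close> is available, so the minimum at parameter 1
    replaces it: \<open>H x \<ge> H y1 + P y1 - P x\<close>. Comparing a minimizer in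
    \<open>P > q\<close> with \<open>x1\<close> then bounds its parameter.\<close>
  obtain y1 where y1: "M 1 y1" using M_ex[of 1] by auto
  define D where "D = H x1 - (H y1 + P y1) + P x1"
  have "\<mu> \<le> 1 + D / (q - P x1)" if \<mu>: "\<mu> \<in> S" for \<mu>
  proof -
    obtain x where x: "M \<mu> x" "q < P x" "\<mu> > 0" using \<mu> by (auto simp: S_def)
    have "H y1 + P y1 \<le> H x + P x" using M_le[OF y1, of x] by simp
    then have D: "(\<mu> - 1) * (P x - P x1) \<le> D"
      using M_le[OF x(1), of x1] by (simp add: D_def algebra_simps)
    have D0: "0 \<le> D" using M_le[OF y1, of x1] by (simp add: D_def)
    have "(\<mu> - 1) * (q - P x1) \<le> D"
    proof (cases "\<mu> \<ge> 1")
      case True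
      then have "(\<mu> - 1) * (q - P x1) \<le> (\<mu> - 1) * (P x - P x1)"
        using x by (intro mult_left_mono) auto
      then show ?thesis using D by simp
    next
      case False
      then have "(\<mu> - 1) * (q - P x1) \<le> 0" using x1(1) by (simp add: mult_nonpos_nonneg)
      then show ?thesis using D0 by simp
    qed
    then show ?thesis using x1(1) by (simp add: field_simps)
  qed
  then have bdd: "bdd_above S" by (rule bdd_aboveI)
  define \<nu> where "\<nu> = Sup S"
  have \<nu>: "\<nu> > 0" using \<mu>0 cSup_upper[OF S0 bdd] by (simp add: \<nu>_def)

  \<comment> \<open>Approach from within \<open>S\<close>; the sequence may be constant if
    \<open>\<nu>\<close> belongs to \<open>S\<close>.\<close>
  obtain m where m: "\<And>n. m n \<in> S" "m \<longlonglongrightarrow> \<nu>"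
    using closure_contains_Sup[OF _ bdd] S0 unfolding closure_sequential \<nu>_def by blast
  then obtain \<xi> where \<xi>: "\<And>n. M (m n) (\<xi> n)" "\<And>n. q < P (\<xi> n)"
    unfolding S_def by simp metis
  obtain x \<rho> where x: "(\<lambda>n. P (\<xi> (\<rho> n))) \<longlonglongrightarrow> P x" "M \<nu> x"
    by (rule global_minimum_limit[OF H P p compact m(2) \<nu> \<xi>(1)[unfolded M_def]])
      (auto simp: M_def)
  have "q \<le> P x" using \<xi>(2) by (intro LIMSEQ_le_const[OF x(1)]) (auto intro: less_imp_le)

  \<comment> \<open>Parameters strictly above \<open>Sup S\<close> lie outside \<open>S\<close>, so
    all their minimizers satisfy \<open>P \<le> q\<close>.\<close>
  define m' where "m' n = \<nu> + inverse (real (Suc n))" for n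
  have m'_gt: "\<nu> < m' n" for n by (simp add: m'_def)
  have m': "m' \<longlonglongrightarrow> \<nu>"
    unfolding m'_def using tendsto_add[OF tendsto_const LIMSEQ_inverse_real_of_nat, of \<nu>] by simp
  have "\<exists>y. M (m' n) y" for n using M_ex[of "m' n"] m'_gt[of n] \<nu> by auto
  then obtain \<eta> where \<eta>: "\<And>n. M (m' n) (\<eta> n)" by metis
  have "m' n \<notin> S" for n
    using cSup_upper[OF _ bdd, of "m' n"] m'_gt[of n] by (auto simp: \<nu>_def)
  then have \<eta>q: "P (\<eta> n) \<le> q" for n
    using \<eta>[of n] m'_gt[of n] \<nu> by (force simp: S_def)
  obtain y \<sigma> where y: "(\<lambda>n. P (\<eta> (\<sigma> n))) \<longlonglongrightarrow> P y" "M \<nu> y"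
    by (rule global_minimum_limit[OF H P p compact m' \<nu> \<eta>[unfolded M_def]])
      (auto simp: M_def)
  have "P y \<le> q" using \<eta>q by (intro LIMSEQ_le_const2[OF y(1)]) auto
  \<comment> \<open>As \<open>P x = q\<close> is excluded, \<open>P y \<le> q < P x\<close>.\<close>
  then have "x \<noteq> y" using \<open>q \<le> P x\<close> M_neq[OF x(2) \<nu>] by force
  then show ?thesis using \<nu> x(2) y(2) by (auto simp: M_def)
qed

section \<open>Choice of the sequence and reduction to two parameters\<close>

theorem theorem2:
  fixes I J :: "'a::topological_space \<Rightarrow> real" and c :: real
  assumes "seq_lsc I" and "seq_lsc J"
    and "seq_inf_compact J"
    and "c > 0"
    and "(INF x\<in>J -` {c<..}. ereal (I x / J x)) = - \<infinity>"
  shows "\<exists>lam :: nat \<Rightarrow> real.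
           (\<forall>n. lam n > 0) \<and> filterlim lam at_top sequentially \<and>
           (\<forall>n. \<forall>\<phi> :: real \<Rightarrow> real.
              strict_mono_on (range J) \<phi> \<and> lsc_on (range J) \<phi> \<and>
              (\<forall>\<mu>>0. seq_inf_compact (\<lambda>x. I x + \<mu> * \<phi> (J x))) \<longrightarrow>
              (\<exists>\<nu>>0. \<exists>x y. x \<noteq> y \<and>
                 global_minimum (\<lambda>z. I z + lam n * J z + \<nu> * \<phi> (J z)) x \<and>
                 global_minimum (\<lambda>z. I z + lam n * J z + \<nu> * \<phi> (J z)) y))"
proof -
  obtain x1 where x1: "\<And>y. J x1 \<le> J y"
    using seq_inf_compact_attains_inf[OF assms(2,3)] by blast
  have bounded: "\<exists>B. \<forall>x. J x \<le> s \<longrightarrow> B \<le> I x" for s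
  proof (cases "J -` {..s} = {}")
    case True
    then show ?thesis by auto
  next
    case False
    then obtain x where "\<And>y. y \<in> J -` {..s} \<Longrightarrow> I x \<le> I y"
      using seq_lsc_attains_inf[OF assms(1)] assms(3) unfolding seq_inf_compact_def by metis
    then show ?thesis by auto
  qed
  have unbounded: "\<exists>x. I x + k * J x < V" for k V
  proof -
    \<comment> \<open>The term \<open>\<bar>V\<bar> / c\<close> is scaled so that multiplying by
      \<open>J x > c\<close> yields at least \<open>\<bar>V\<bar>\<close>; hence
      \<open>I x + k * J x < - \<bar>V\<bar> \<le> V\<close>.\<close>
    have "(INF x\<in>J -` {c<..}. ereal (I x / J x)) < ereal (- (k + \<bar>V\<bar> / c))"
      using assms(5) by simp
    then obtain x where x: "c < J x" "I x / J x < - (k + \<bar>V\<bar> / c)"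
      by (auto simp: INF_less_iff)
    then have "I x < - (k + \<bar>V\<bar> / c) * J x"
      using assms(4) by (simp add: pos_divide_less_eq)
    moreover have "\<bar>V\<bar> \<le> \<bar>V\<bar> / c * J x"
      using x(1) assms(4) mult_left_mono[of c "J x" "\<bar>V\<bar>"] by (simp add: field_simps)
    ultimately show ?thesis
      by (intro exI[of _ x]) (simp add: algebra_simps abs_if split: if_splits)
  qed
  \<comment> \<open>With \<open>k = 0\<close>, \<open>I\<close> is unbounded below on the space but
    bounded below where \<open>J\<close> is minimal, so \<open>J\<close> takes a larger
    value.\<close>
  obtain xs where xs: "J x1 < J xs"
    using bounded[of "J x1"] unbounded[of 0] by (metis add.right_neutral mult_zero_left not_le)
  define s where "s = J xs"
  obtain B where B: "\<And>x. J x \<le> s \<Longrightarrow> B \<le> I x" using bounded by blast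
  \<comment> \<open>The quotient makes \<open>\<lambda> * (s - J x1) \<ge> I x1 - B\<close> for
    \<open>\<lambda> \<ge> l\<close>, and the 1 ensures positivity. Nothing here depends on
    \<open>\<phi>\<close>, so one sequence serves every \<open>\<phi>\<close>.\<close>
  define l where "l = max 1 ((I x1 - B) / (s - J x1))"
  define lam where "lam n = l + real n" for n
  have "filterlim (\<lambda>n. l + real n) at_top sequentially"
    by (intro filterlim_tendsto_add_at_top[OF tendsto_const] filterlim_real_sequentially)
  then have lim: "filterlim lam at_top sequentially" by (simp add: lam_def[abs_def])
  have pos: "lam n > 0" for n by (simp add: lam_def l_def add_pos_nonneg)
  have "\<exists>\<nu>>0. \<exists>x y. x \<noteq> y \<and>
          global_minimum (\<lambda>z. I z + lam n * J z + \<nu> * \<phi> (J z)) x \<and>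
          global_minimum (\<lambda>z. I z + lam n * J z + \<nu> * \<phi> (J z)) y"
    if mono: "strict_mono_on (range J) \<phi>" and lsc: "lsc_on (range J) \<phi>"
      and compact: "\<And>\<mu>. \<mu> > 0 \<Longrightarrow> seq_inf_compact (\<lambda>x. I x + \<mu> * \<phi> (J x))" for n \<phi>
  proof -
    have less_iff: "\<phi> (J x) < \<phi> (J y) \<longleftrightarrow> J x < J y" for x y
      using mono by (auto simp: strict_mono_on_less)
    have le_iff: "\<phi> (J x) \<le> \<phi> (J y) \<longleftrightarrow> J x \<le> J y" for x y
      using less_iff[of y x] by (simp flip: not_less)
    have P: "seq_lsc (\<lambda>x. \<phi> (J x))"
      using assms(2) strict_mono_on_imp_mono_on[OF mono] lsc by (rule seq_lsc_compose_mono)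
    have H: "seq_lsc (\<lambda>x. I x + lam n * J x)"
      using assms(1,2) pos by (intro seq_lsc_add seq_lsc_cmult)
    have J1: "lam n * J x1 \<le> lam n * J x" for x
      using x1 pos[of n] by simp
    have gap: "lam n * (s - J x1) \<ge> I x1 - B"
    proof -
      have "(I x1 - B) / (s - J x1) \<le> lam n" by (simp add: lam_def l_def)
      then show ?thesis using xs by (simp add: s_def pos_divide_le_eq)
    qed
    \<comment> \<open>The right-hand side is a lower bound for \<open>I + lam n * J\<close> on
      \<open>J \<le> s\<close>.\<close>
    obtain x2 where x2: "I x2 + lam n * J x2 < B + lam n * J x1" using unbounded by blast
    show ?thesis
    proof (rule two_global_minima[OF H P, where q = "\<phi> s" and W = "B + lam n * J x1"])
      show "\<phi> (J x1) \<le> \<phi> (J x)" for x using x1 by (simp add: le_iff)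
      show "seq_inf_compact (\<lambda>x. I x + lam n * J x + \<mu> * \<phi> (J x))" if "\<mu> > 0" for \<mu>
      proof (rule seq_inf_compact_mono[OF compact[OF that]])
        show "seq_lsc (\<lambda>x. I x + lam n * J x + \<mu> * \<phi> (J x))"
          using H P that by (intro seq_lsc_add[OF H] seq_lsc_cmult)
        \<comment> \<open>The added term \<open>lam n * J\<close> is bounded below by its value at
          \<open>x1\<close>, which gives the constant.\<close>
        show "I x + \<mu> * \<phi> (J x) \<le> I x + lam n * J x + \<mu> * \<phi> (J x) + (- lam n * J x1)" for x
          using J1[of x] by simp
      qed
      show "\<phi> (J x1) < \<phi> s" using xs by (simp add: s_def less_iff)
      show "I x1 + lam n * J x1 \<le> I x + lam n * J x" if "\<phi> (J x) = \<phi> s" for x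
      proof -
        \<comment> \<open>Strict monotonicity identifies the level of
          \<open>\<phi> \<circ> J\<close> with that of \<open>J\<close>; there the choice of
          \<open>l\<close> gives the comparison with \<open>x1\<close>.\<close>
        have "J x = s" using that le_iff[of x xs] le_iff[of xs x] by (simp add: s_def)
        then show ?thesis using gap B[of x] by (simp add: algebra_simps)
      qed
      show "B + lam n * J x1 \<le> I x + lam n * J x" if "\<phi> (J x) \<le> \<phi> s" for x
        using that B[of x] J1[of x] by (simp add: s_def le_iff)
    qed (fact x2)
  qed
  then show ?thesis using pos lim by (intro exI[of _ lam] conjI allI impI) simp_all
qed

end
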